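(* For every integer $n\ge 1$ the following congruences hold: $$C_{2n} \equiv (n+1) C_n \pmod 2,$$ $$(2n+1) C_{2n} \equiv (n+1) C_n \pmod 4,$$ $$(2n+1) C_{2n} \equiv (n+1) C_n - 4n^2 C_{n-1} \pmod{8},$$ $$(2n+1) C_{2n} \equiv (n+1) C_n + 4n^2 (2n-1) C_{n-1} \pmod{16},$$ and $$(n+1) C_{2n+1} \equiv (n+1) C_n \pmod 2,$$ $$(n+1) C_{2n+1} \equiv (n+1) (2n+1) C_n \pmod 4,$$ $$(n+1) C_{2n+1} \equiv (n+1) (2n+1) C_n + 4n \binom{2n+1}{3} C_{n-1} \pmod{16}$$ (the last one hence also modulo $8$).
   Context: $C_n=\frac{1}{n+1}\binom{2n}{n}$ ($n\ge 0$) denotes the $n$-th Catalan number. *)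

theory Defs
  imports Complex_Main "HOL-Number_Theory.Cong"
begin

definition catalan :: "nat \<Rightarrow> nat" where
  "catalan n = ((2 * n) choose n) div (n + 1)"

text \<open>The division in \<open>catalan\<close> is exact, so it is the rational expression
  \<open>1/(n+1) * binomial(2n,n)\<close>.\<close>

lemma Suc_dvd_central_binomial: "n + 1 dvd ((2 * n) choose n)"
proof -
  have "Suc n * ((2 * n) choose Suc n) = (2 * n - n) * ((2 * n) choose n)"
    by (simp only: binomial_absorb_comp binomial_absorption)
  then have "Suc n dvd n * ((2 * n) choose n)"
    by (metis dvd_triv_left mult_2 add_diff_cancel_left')
  moreover have "coprime (Suc n) n" by simp
  ultimately show ?thesis
    by (simp add: coprime_dvd_mult_right_iff)
qed

lemma of_nat_catalan:
  "real (catalan n) = 1 / (real n + 1) * real ((2 * n) choose n)"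
  using Suc_dvd_central_binomial[of n]
  by (simp add: catalan_def real_of_nat_div add.commute)

end

theory Submission
  imports Defs "HOL-Computational_Algebra.Polynomial"
begin

text \<open>Comparing the coefficients of \<open>x^m\<close> in \<open>(1 + x)^(2m) = ((1 + x\<^sup>2) + 2x)^m\<close> writes
  \<open>2m choose m\<close> as the sum of \<open>2^j (m choose j) ((m - j) choose ((m - j)/2))\<close> over all
  \<open>j \<le> m\<close> of the same parity as \<open>m\<close>. Modulo 16 only \<open>j = 0, 2\<close> survive for \<open>m = 2n\<close>, and modulo
  32 only \<open>j = 1, 3\<close> survive for \<open>m = 2n + 1\<close>; in the latter case the factor 2 cancels because
  \<open>4n + 2 choose 2n + 1\<close> equals \<open>2 (n + 1) C(2n + 1)\<close>.\<close>

text \<open>Only even powers of \<open>x\<close> occur in the binomial expansion of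
  \<open>(1 + x^2)^k\<close>, so degree \<open>k\<close> is missed when \<open>k\<close> is odd.
  This is the source of the parity condition in the next lemma.\<close>

lemma coeff_one_plus_X_squared_power:
  "coeff ([:1, 0, 1 :: 'a :: comm_ring_1:] ^ k) k
     = (if even k then of_nat (k choose (k div 2)) else 0)"
proof -
  have "[:1, 0, 1 :: 'a:] = monom 1 2 + 1"
    by (simp add: monom_altdef power2_eq_square one_pCons)
  also have "(monom (1 :: 'a) 2 + 1) ^ k = (\<Sum>j\<le>k. monom (of_nat (k choose j)) (2 * j))"
    by (subst binomial_ring) (simp add: monom_power of_nat_poly smult_monom)
  finally have *: "coeff ([:1, 0, 1 :: 'a:] ^ k) k
      = (\<Sum>j\<le>k. if 2 * j = k then of_nat (k choose j) else 0)"
    by (simp add: coeff_sum)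
  show ?thesis
  proof (cases "even k")
    case True
    then have "2 * j = k \<longleftrightarrow> j = k div 2" for j by auto
    with True * show ?thesis by simp
  next
    case False
    then have "2 * j \<noteq> k" for j by auto
    with False * show ?thesis by simp
  qed
qed

lemma central_binomial_parity_sum:
  "int ((2 * m) choose m) = (\<Sum>j\<le>m. if even (m - j)
     then 2 ^ j * int (m choose j) * int ((m - j) choose ((m - j) div 2)) else 0)"
proof -
  have "[:1, 1 :: int:] ^ (2 * m) = (monom 2 1 + [:1, 0, 1:]) ^ m"
    by (simp add: power_mult power2_eq_square monom_altdef)
  also have "\<dots> = (\<Sum>j\<le>m. monom (2 ^ j * int (m choose j)) j * [:1, 0, 1:] ^ (m - j))"
    by (subst binomial_ring) (simp add: monom_power of_nat_poly smult_monom mult.commute)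
  \<comment> \<open>In the \<open>j\<close>-th summand the monomial already supplies degree
    \<open>j\<close>, so the remaining power has to supply degree \<open>m - j\<close>, which equals
    its exponent: the case covered by the previous lemma.\<close>
  finally have "int ((2 * m) choose m) = (\<Sum>j\<le>m. 2 ^ j * int (m choose j)
      * coeff ([:1, 0, 1:] ^ (m - j)) (m - j))"
    using coeff_linear_poly_power[of m "2 * m" "1 :: int" 1]
    by (simp add: coeff_sum coeff_monom_mult)
  then show ?thesis
    by (simp add: coeff_one_plus_X_squared_power if_distrib cong: if_cong)
qed

lemma central_binomial_even_cong_16:
  assumes "n \<ge> 1"
  shows "[int ((4 * n) choose (2 * n)) = int ((2 * n) choose n)
    + 4 * int ((2 * n) choose 2) * int ((2 * (n - 1)) choose (n - 1))] (mod 16)"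
proof -
  define f where "f j = (if even (2 * n - j) then 2 ^ j * int ((2 * n) choose j)
    * int ((2 * n - j) choose ((2 * n - j) div 2)) else 0)" for j
  \<comment> \<open>For \<open>j\<close> equal to 1 or 3, \<open>2 * n - j\<close> is odd and the
    term is zero; the bound \<open>j <= 2 * n\<close> rules out truncated subtraction. From 4 on,
    \<open>2 ^ j\<close> supplies the divisor.\<close>
  have "16 dvd f j" if "j \<in> {..2 * n} - {0, 2}" for j
  proof (cases "j < 4")
    case True
    with that have "j = 1 \<or> j = 3" by auto
    with that show ?thesis by (auto simp: f_def)
  next
    case False
    then have "(2 :: int) ^ 4 dvd 2 ^ j" by (intro le_imp_power_dvd) simp
    then show ?thesis by (auto simp: f_def)
  qed
  then have "16 dvd sum f ({..2 * n} - {0, 2})" by (rule dvd_sum)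
  \<comment> \<open>Splitting off \<open>{0, 2}\<close> requires \<open>2 <= 2 * n\<close>, hence
    \<open>n >= 1\<close>.\<close>
  moreover have "int ((4 * n) choose (2 * n)) = sum f ({..2 * n} - {0, 2}) + sum f {0, 2}"
    using central_binomial_parity_sum[of "2 * n"] assms
    by (subst sum.subset_diff[symmetric]) (auto simp: f_def)
  moreover have "sum f {0, 2} = int ((2 * n) choose n)
    + 4 * int ((2 * n) choose 2) * int ((2 * (n - 1)) choose (n - 1))"
  proof -
    have "2 * n - 2 = 2 * (n - 1)" by simp
    then have "(2 * n - 2) choose ((2 * n - 2) div 2) = (2 * (n - 1)) choose (n - 1)"
      by (metis nonzero_mult_div_cancel_left zero_neq_numeral)
    then show ?thesis by (simp add: f_def)
  qed
  ultimately show ?thesis by (simp add: cong_iff_dvd_diff)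
qed

lemma central_binomial_odd_cong_32:
  assumes "n \<ge> 1"
  shows "[int ((4 * n + 2) choose (2 * n + 1)) = 2 * (int (2 * n + 1) * int ((2 * n) choose n)
    + 4 * int ((2 * n + 1) choose 3) * int ((2 * (n - 1)) choose (n - 1)))] (mod 32)"
proof -
  define f where "f j = (if even (2 * n + 1 - j) then 2 ^ j * int ((2 * n + 1) choose j)
    * int ((2 * n + 1 - j) choose ((2 * n + 1 - j) div 2)) else 0)" for j
  \<comment> \<open>Here \<open>j = 4\<close>, where \<open>2 ^ j\<close> gives only 16, is harmless
    because its parity makes the term zero.\<close>
  have "32 dvd f j" if "j \<in> {..2 * n + 1} - {1, 3}" for j
  proof (cases "j < 5")
    case True
    with that have "j = 0 \<or> j = 2 \<or> j = 4" by auto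
    with that show ?thesis by (auto simp: f_def)
  next
    case False
    then have "(2 :: int) ^ 5 dvd 2 ^ j" by (intro le_imp_power_dvd) simp
    then show ?thesis by (auto simp: f_def)
  qed
  then have "32 dvd sum f ({..2 * n + 1} - {1, 3})" by (rule dvd_sum)
  moreover have "int ((4 * n + 2) choose (2 * n + 1))
      = sum f ({..2 * n + 1} - {1, 3}) + sum f {1, 3}"
    using central_binomial_parity_sum[of "2 * n + 1"] assms
    by (subst sum.subset_diff[symmetric]) (auto simp: f_def)
  moreover have "sum f {1, 3} = 2 * (int (2 * n + 1) * int ((2 * n) choose n)
    + 4 * int ((2 * n + 1) choose 3) * int ((2 * (n - 1)) choose (n - 1)))"
  proof -
    have "2 * n + 1 - 3 = 2 * (n - 1)" by simp
    then have "(2 * n + 1 - 3) choose ((2 * n + 1 - 3) div 2) = (2 * (n - 1)) choose (n - 1)"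
      by (metis nonzero_mult_div_cancel_left zero_neq_numeral)
    moreover have "even (2 * n + 1 - 3)" by simp
    ultimately show ?thesis by (simp add: f_def)
  qed
  ultimately show ?thesis by (simp add: cong_iff_dvd_diff)
qed

lemma Suc_times_catalan: "(int n + 1) * int (catalan n) = int ((2 * n) choose n)"
proof -
  have "(n + 1) * catalan n = (2 * n) choose n"
    using Suc_dvd_central_binomial[of n] unfolding catalan_def by (rule dvd_mult_div_cancel)
  then show ?thesis by (metis of_nat_Suc of_nat_mult Suc_eq_plus1 add.commute)
qed

text \<open>The square of \<open>n\<close> has two sources: one factor from
  \<open>2n choose 2 = n (2n - 1)\<close>, the other from
  \<open>2(n - 1) choose (n - 1) = n C(n - 1)\<close>.\<close>

lemma catalan_double_cong_16:
  assumes "n \<ge> 1"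
  shows "[(2 * int n + 1) * int (catalan (2*n)) = (int n + 1) * int (catalan n)
            + 4 * (int n)^2 * (2 * int n - 1) * int (catalan (n - 1))] (mod 16)"
proof -
  have 1: "int ((2 * (n - 1)) choose (n - 1)) = int n * int (catalan (n - 1))"
    using Suc_times_catalan[of "n - 1"] assms by (simp add: of_nat_diff)
  have "(2 * n) choose 2 = n * (2 * n - 1)"
    by (simp add: choose_two)
  then have 2: "int ((2 * n) choose 2) = int n * (2 * int n - 1)"
    using assms by (simp add: of_nat_diff)
  show ?thesis
    using central_binomial_even_cong_16[OF assms] Suc_times_catalan[of "2 * n"]
    unfolding 1 2 Suc_times_catalan[of n] by (simp add: power2_eq_square mult_ac)
qed

lemma catalan_double_plus_one_cong_16:
  assumes "n \<ge> 1"
  shows "[(int n + 1) * int (catalan (2*n + 1)) = (int n + 1) * (2 * int n + 1) * int (catalan n)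
            + 4 * int n * int ((2*n + 1) choose 3) * int (catalan (n - 1))] (mod 16)"
proof -
  have 1: "int ((2 * (n - 1)) choose (n - 1)) = int n * int (catalan (n - 1))"
    using Suc_times_catalan[of "n - 1"] assms by (simp add: of_nat_diff)
  have 2: "int ((4 * n + 2) choose (2 * n + 1)) = 2 * ((int n + 1) * int (catalan (2 * n + 1)))"
    using Suc_times_catalan[of "2 * n + 1"] by (simp add: algebra_simps)
  \<comment> \<open>Both sides and the modulus 32 are displayed with a factor 2, so that it cancels
    from the divisibility and leaves 16.\<close>
  have "[2 * ((int n + 1) * int (catalan (2 * n + 1))) = 2 * ((int n + 1) * (2 * int n + 1) * int (catalan n)
            + 4 * int n * int ((2*n + 1) choose 3) * int (catalan (n - 1)))] (mod (2 * 16))"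
    using central_binomial_odd_cong_32[OF assms]
    unfolding 1 2 Suc_times_catalan[of n, symmetric] by (simp add: mult_ac add_ac)
  then show ?thesis
    unfolding cong_iff_dvd_diff right_diff_distrib[symmetric]
    by (simp only: dvd_mult_cancel_left) simp
qed

theorem mainTheorem13:
  fixes n :: nat
  assumes "n \<ge> 1"
  shows "[int (catalan (2*n)) = (int n + 1) * int (catalan n)] (mod 2) \<and>
    [(2 * int n + 1) * int (catalan (2*n)) = (int n + 1) * int (catalan n)] (mod 4) \<and>
    [(2 * int n + 1) * int (catalan (2*n))
          = (int n + 1) * int (catalan n) - 4 * (int n)^2 * int (catalan (n - 1))] (mod 8) \<and>
    [(2 * int n + 1) * int (catalan (2*n))
          = (int n + 1) * int (catalan n)
            + 4 * (int n)^2 * (2 * int n - 1) * int (catalan (n - 1))] (mod 16) \<and>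
    [(int n + 1) * int (catalan (2*n + 1)) = (int n + 1) * int (catalan n)] (mod 2) \<and>
    [(int n + 1) * int (catalan (2*n + 1))
          = (int n + 1) * (2 * int n + 1) * int (catalan n)] (mod 4) \<and>
    [(int n + 1) * int (catalan (2*n + 1))
          = (int n + 1) * (2 * int n + 1) * int (catalan n)
            + 4 * int n * int ((2*n + 1) choose 3) * int (catalan (n - 1))] (mod 8) \<and>
    [(int n + 1) * int (catalan (2*n + 1))
          = (int n + 1) * (2 * int n + 1) * int (catalan n)
            + 4 * int n * int ((2*n + 1) choose 3) * int (catalan (n - 1))] (mod 16)"
proof -
  let ?a = "int n" and ?c = "int (catalan n)" and ?d = "int (catalan (n - 1))"
  let ?b = "int ((2 * n + 1) choose 3)"
  let ?x = "int (catalan (2 * n))" and ?y = "int (catalan (2 * n + 1))"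
  \<comment> \<open>With the two congruences modulo 16 as equations in \<open>k\<close> and
    \<open>l\<close>, each weaker congruence follows by exhibiting the quotient explicitly.\<close>
  obtain k where k: "(2 * ?a + 1) * ?x
      = (?a + 1) * ?c + 4 * ?a\<^sup>2 * (2 * ?a - 1) * ?d + 16 * k"
    using catalan_double_cong_16[OF assms] by (metis cong_iff_lin cong_sym)
  obtain l where l: "(?a + 1) * ?y
      = (?a + 1) * (2 * ?a + 1) * ?c + 4 * ?a * ?b * ?d + 16 * l"
    using catalan_double_plus_one_cong_16[OF assms] by (metis cong_iff_lin cong_sym)
  \<comment> \<open>The factor \<open>2 * ?a + 1\<close> disappears by moving
    \<open>2 * ?a * ?x\<close> to the right, where it is absorbed in the even quotient.\<close>
  have "?x - (?a + 1) * ?c = 2 * (2 * ?a\<^sup>2 * (2 * ?a - 1) * ?d + 8 * k - ?a * ?x)"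
    using k by (simp add: algebra_simps)
  moreover have "(2 * ?a + 1) * ?x - (?a + 1) * ?c = 4 * (?a\<^sup>2 * (2 * ?a - 1) * ?d + 4 * k)"
    using k by (simp add: algebra_simps)
  \<comment> \<open>The cube arises from \<open>4 a^2 (2a - 1) + 4 a^2 = 8 a^3\<close>.\<close>
  moreover have "(2 * ?a + 1) * ?x - ((?a + 1) * ?c - 4 * ?a\<^sup>2 * ?d) = 8 * (?a ^ 3 * ?d + 2 * k)"
    using k by (simp add: algebra_simps power2_eq_square power3_eq_cube)
  \<comment> \<open>Replacing \<open>2 * ?a + 1\<close> by 1 costs the even term
    \<open>2 a (a + 1) c\<close>.\<close>
  moreover have "(?a + 1) * ?y - (?a + 1) * ?c
      = 2 * (?a * (?a + 1) * ?c + 2 * ?a * ?b * ?d + 8 * l)"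
    using l by (simp add: algebra_simps)
  moreover have "(?a + 1) * ?y - (?a + 1) * (2 * ?a + 1) * ?c = 4 * (?a * ?b * ?d + 4 * l)"
    using l by (simp add: algebra_simps)
  moreover have "(?a + 1) * ?y - ((?a + 1) * (2 * ?a + 1) * ?c + 4 * ?a * ?b * ?d) = 8 * (2 * l)"
    using l by (simp add: algebra_simps)
  ultimately show ?thesis
    using catalan_double_cong_16[OF assms] catalan_double_plus_one_cong_16[OF assms]
    unfolding cong_iff_dvd_diff by (metis dvd_triv_left)
qed

end
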